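(* Let $\nu$ be a lattice path. Then $|\mathcal{LP}_\nu| = 2\,|\mathcal{P}_\nu|$ if and only if $\nu$ begins with a north step and ends with an east step. Here $\mathcal{P}_\nu$ is the set of (small) $\nu$-Schröder paths and $\mathcal{LP}_\nu$ is the set of large $\nu$-Schröder paths.
   Context: A lattice path from $(0,0)$ to $(b,a)\in\mathbb{Z}_{\ge 0}^2$ is a sequence of $a$ north steps $N=(0,1)$ and $b$ east steps $E=(1,0)$. A Schröder path from $(0,0)$ to $(b,a)$ is a path from $(0,0)$ to $(b,a)$ whose steps are $N=(0,1)$, $E=(1,0)$ and $D=(1,1)$. Let $\nu$ be a lattice path from $(0,0)$ to $(b,a)$. A peak of a lattice path is a consecutive pair $NE$. Let $\mu$ be the path obtained from $\nu$ by replacing each peak $NE$ of $\nu$ with a diagonal step $D$. A (small) $\nu$-Schröder path is a Schröder path from $(0,0)$ to $(b,a)$ which stays weakly above $\nu$. A large $\nu$-Schröder path is a Schröder path from $(0,0)$ to $(b,a)$ which stays weakly above $\mu$. *)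

theory Defs
  imports "HOL-Analysis.Analysis"
begin

datatype step = North | East | Diag

fun step_vec :: "step \<Rightarrow> nat \<times> nat" where
  "step_vec North = (0, 1)"
| "step_vec East = (1, 0)"
| "step_vec Diag = (1, 1)"

(* Points are pairs (x, y), so a path to (b, a) uses b units east and a units north.
   All paths start at the origin. *)
definition schroder_path :: "step list \<Rightarrow> nat \<times> nat \<Rightarrow> bool" where
  "schroder_path p z \<longleftrightarrow>
     (\<Sum>s\<leftarrow>p. fst (step_vec s)) = fst z \<and> (\<Sum>s\<leftarrow>p. snd (step_vec s)) = snd z"

definition lattice_path :: "step list \<Rightarrow> nat \<times> nat \<Rightarrow> bool" where
  "lattice_path p z \<longleftrightarrow> schroder_path p z \<and> set p \<subseteq> {North, East}"

fun path_points_from :: "real \<times> real \<Rightarrow> step list \<Rightarrow> (real \<times> real) set" where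
  "path_points_from z [] = {z}"
| "path_points_from z (s # p) =
     (let z' = z + map_prod real real (step_vec s)
      in closed_segment z z' \<union> path_points_from z' p)"

definition path_points :: "step list \<Rightarrow> (real \<times> real) set" where
  "path_points p = path_points_from (0, 0) p"

(* Every point of p has a point of q directly below it or equal to it. The comparison
   ranges over the whole curves: comparing only lattice points would wrongly put the
   single step D weakly above NE. For paths with common endpoints, asking for just one
   point of q on the vertical line also handles the vertical segments correctly, since
   paths are monotone and all points of p are compared. *)
definition weakly_above :: "step list \<Rightarrow> step list \<Rightarrow> bool" where
  "weakly_above p q \<longleftrightarrow> (\<forall>(x, y) \<in> path_points p. \<exists>y'. (x, y') \<in> path_points q \<and> y' \<le> y)"

fun peaks_to_diag :: "step list \<Rightarrow> step list" where
  "peaks_to_diag (North # East # p) = Diag # peaks_to_diag p"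
| "peaks_to_diag (s # p) = s # peaks_to_diag p"
| "peaks_to_diag [] = []"

definition small_schroder_paths :: "nat \<times> nat \<Rightarrow> step list \<Rightarrow> step list set" where
  "small_schroder_paths z \<nu> = {p. schroder_path p z \<and> weakly_above p \<nu>}"

definition large_schroder_paths :: "nat \<times> nat \<Rightarrow> step list \<Rightarrow> step list set" where
  "large_schroder_paths z \<nu> = {p. schroder_path p z \<and> weakly_above p (peaks_to_diag \<nu>)}"

end

theory Submission
  imports Defs
begin

text \<open>
  A path is determined up to its north steps by the heights at which it crosses the unit columns,
  and being weakly above is a columnwise comparison of these heights. Hence a path \<open>p\<close> is weakly
  above \<open>\<nu>\<close> iff the lattice path obtained from \<open>p\<close> by \<open>D \<mapsto> EN\<close> is, and \<open>p\<close> is weakly above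
  \<open>\<mu>\<close> iff the lattice path obtained by \<open>D \<mapsto> NE\<close> is weakly above \<open>\<nu>\<close>. So, with \<open>\<pi>\<close> ranging over
  the lattice paths weakly above \<open>\<nu>\<close>, the small paths number the sum of the \<open>2 ^ valleys \<pi>\<close>, and
  the large ones the sum of the \<open>2 ^ peaks \<pi>\<close>. Always \<open>peaks \<pi> \<le> valleys \<pi> + 1\<close>, with equality
  iff \<open>\<pi>\<close> starts with \<open>N\<close> and ends with \<open>E\<close>. If \<open>\<nu>\<close> has this shape then so does every \<open>\<pi>\<close>;
  if not, then \<open>\<pi> = \<nu>\<close> makes the inequality of the sums strict.
\<close>

section \<open>Column heights\<close>

text \<open>One entry per unit column: the heights of the curve at its left and right edge. North
  steps show only through later heights, so those after the last column leave no trace.\<close>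

fun column_heights :: "nat \<Rightarrow> step list \<Rightarrow> (nat \<times> nat) list" where
  "column_heights j [] = []"
| "column_heights j (North # p) = column_heights (Suc j) p"
| "column_heights j (East # p) = (j, j) # column_heights j p"
| "column_heights j (Diag # p) = (j, Suc j) # column_heights (Suc j) p"

text \<open>The curve is affine over a column, so comparing at both edges compares the whole
  column.\<close>

definition col_le :: "nat \<times> nat \<Rightarrow> nat \<times> nat \<Rightarrow> bool" where
  "col_le c d \<longleftrightarrow> fst c \<le> fst d \<and> snd c \<le> snd d"

lemma length_columns: "length (column_heights j p) = (\<Sum>s\<leftarrow>p. fst (step_vec s))"
  by (induction j p rule: column_heights.induct) auto

lemma columns_append:
  "column_heights j (p @ q) = column_heights j p @ column_heights (j + (\<Sum>s\<leftarrow>p. snd (step_vec s))) q"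
  by (induction j p rule: column_heights.induct) auto

lemma columns_bounds:
  "(s, t) \<in> set (column_heights j p) \<Longrightarrow>
     j \<le> s \<and> s \<le> t \<and> t \<le> Suc s \<and> t \<le> j + (\<Sum>s\<leftarrow>p. snd (step_vec s))"
  by (induction j p rule: column_heights.induct) fastforce+

lemma columns_lattice:
  "Diag \<notin> set p \<Longrightarrow> (s, t) \<in> set (column_heights j p) \<Longrightarrow> s = t"
  by (induction j p rule: column_heights.induct) auto

text \<open>Lets an induction on another path peel off a column of \<open>p\<close>: past it,
  \<open>p\<close> continues from the right height \<open>t\<close>.\<close>

lemma columns_Cons_tail: "column_heights j p = (s, t) # cs \<Longrightarrow> \<exists>p'. cs = column_heights t p'"
  by (induction j p rule: column_heights.induct) auto

section \<open>Points of the curve and its columns\<close>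

lemma path_points_from_columns:
  assumes "k < length (column_heights j p)" "column_heights j p ! k = (s, t)" "0 \<le> u" "u \<le> 1"
  shows "(i + real k + u, real s + u * (real t - real s)) \<in> path_points_from (i, real j) p"
  using assms
proof (induction j p arbitrary: i k rule: column_heights.induct)
  case (2 j p)
  then show ?case using "2.IH"[of k i] by (simp add: Let_def add.commute)
next
  case (3 j p)
  show ?case
  proof (cases k)
    case 0
    with 3 have "(i + real k + u, real s + u * (real t - real s))
        \<in> closed_segment (i, real j) (i + 1, real j)"
      by (auto simp: in_segment algebra_simps intro!: exI[of _ u])
    then show ?thesis by (simp add: Let_def)
  next
    case (Suc k')
    then show ?thesis using 3 "3.IH"[of k' "i + 1"] by (simp add: Let_def algebra_simps)
  qed
next
  case (4 j p)
  show ?case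
  proof (cases k)
    case 0
    with 4 have "(i + real k + u, real s + u * (real t - real s))
        \<in> closed_segment (i, real j) (i + 1, real j + 1)"
      by (auto simp: in_segment algebra_simps intro!: exI[of _ u])
    then show ?thesis by (simp add: Let_def)
  next
    case (Suc k')
    then show ?thesis using 4 "4.IH"[of k' "i + 1"] by (simp add: Let_def algebra_simps)
  qed
qed simp

text \<open>A point on a vertical segment lies above the right end of the column before it. Only
  before the first column is there none, hence the case \<open>x = i\<close>.\<close>

lemma path_points_from_above_columns:
  assumes "(x, y) \<in> path_points_from (i, real j) p"
  shows "x = i \<and> real j \<le> y \<or>
    (\<exists>k s t u. k < length (column_heights j p) \<and> column_heights j p ! k = (s, t) \<and> 0 \<le> u \<and> u \<le> 1 \<and>
       x = i + real k + u \<and> real s + u * (real t - real s) \<le> y)"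
  using assms
proof (induction j p arbitrary: i rule: column_heights.induct)
  case (2 j p)
  then consider "(x, y) \<in> closed_segment (i, real j) (i, real j + 1)"
    | "(x, y) \<in> path_points_from (i, real (Suc j)) p"
    by (auto simp: Let_def add.commute)
  then show ?case
  proof cases
    case 1
    then have "x = i \<and> real j \<le> y"
      by (auto simp: in_segment algebra_simps)
    then show ?thesis by simp
  next
    case 2
    from "2.IH"[OF this] show ?thesis by auto
  qed
next
  case (3 j p)
  then consider "(x, y) \<in> closed_segment (i, real j) (i + 1, real j)"
    | "(x, y) \<in> path_points_from (i + 1, real j) p"
    by (auto simp: Let_def)
  then show ?case
  proof cases
    case 1
    then obtain u where "0 \<le> u" "u \<le> 1" "x = i + u" "y = real j"
      by (auto simp: in_segment algebra_simps)
    then show ?thesis by (intro disjI2 exI[of _ 0] exI[of _ j] exI[of _ u]) auto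
  next
    case 2
    from "3.IH"[OF this] show ?thesis
    proof (elim disjE exE conjE)
      \<comment> \<open>Points straight above the end of this step are charged to its right edge,
        \<open>u = 1\<close>.\<close>
      assume "x = i + 1" "real j \<le> y"
      then show ?thesis by (intro disjI2 exI[of _ 0] exI[of _ j] exI[of _ 1]) auto
    next
      fix k s t u
      assume "k < length (column_heights j p)" "column_heights j p ! k = (s, t)" "0 \<le> u" "u \<le> 1"
        "x = i + 1 + real k + u" "real s + u * (real t - real s) \<le> y"
      then show ?thesis
        by (intro disjI2 exI[of _ "Suc k"] exI[of _ s] exI[of _ t] exI[of _ u]) auto
    qed
  qed
next
  case (4 j p)
  then consider "(x, y) \<in> closed_segment (i, real j) (i + 1, real j + 1)"
    | "(x, y) \<in> path_points_from (i + 1, real (Suc j)) p"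
    by (auto simp: Let_def add.commute)
  then show ?case
  proof cases
    case 1
    then obtain u where "0 \<le> u" "u \<le> 1" "x = i + u" "y = real j + u"
      by (auto simp: in_segment algebra_simps)
    then show ?thesis
      by (intro disjI2 exI[of _ 0] exI[of _ j] exI[of _ "Suc j"] exI[of _ u]) auto
  next
    case 2
    from "4.IH"[OF this] show ?thesis
    proof (elim disjE exE conjE)
      assume "x = i + 1" "real (Suc j) \<le> y"
      then show ?thesis
        by (intro disjI2 exI[of _ 0] exI[of _ j] exI[of _ "Suc j"] exI[of _ 1]) auto
    next
      fix k s t u
      assume "k < length (column_heights (Suc j) p)" "column_heights (Suc j) p ! k = (s, t)" "0 \<le> u" "u \<le> 1"
        "x = i + 1 + real k + u" "real s + u * (real t - real s) \<le> y"
      then show ?thesis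
        by (intro disjI2 exI[of _ "Suc k"] exI[of _ s] exI[of _ t] exI[of _ u]) auto
    qed
  qed
qed simp

lemma start_in_path_points_from: "z \<in> path_points_from z p"
  by (cases p) (auto simp: Let_def)

text \<open>Forward, one test point per column is enough. Backward, convex combinations of the two
  edge inequalities cover the column, and the common origin covers the line
  \<open>x = 0\<close>.\<close>

lemma weakly_above_iff_columns:
  assumes len: "length (column_heights 0 p) = length (column_heights 0 q)"
  shows "weakly_above p q \<longleftrightarrow> list_all2 col_le (column_heights 0 q) (column_heights 0 p)"
proof
  assume above: "weakly_above p q"
  have "col_le (column_heights 0 q ! k) (column_heights 0 p ! k)" if k: "k < length (column_heights 0 p)" for k
  proof -
    obtain s t where p: "column_heights 0 p ! k = (s, t)" by force
    obtain s' t' where q: "column_heights 0 q ! k = (s', t')" by force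
    have st: "s \<le> t" "t \<le> Suc s"
      using columns_bounds[of s t 0 p] k p by (metis nth_mem)+
    have st': "s' \<le> t'" "t' \<le> Suc s'"
      using columns_bounds[of s' t' 0 q] k q len by (metis nth_mem)+
    \<comment> \<open>Column heights are integers of slope 0 or 1, so the midpoint of the column decides.\<close>
    have "(real k + 1/2, real s + 1/2 * (real t - real s)) \<in> path_points p"
      using path_points_from_columns[OF k p, of "1/2" 0] by (simp add: path_points_def)
    then obtain y where y: "(real k + 1/2, y) \<in> path_points q"
        "y \<le> real s + 1/2 * (real t - real s)"
      using above by (fastforce simp: weakly_above_def)
    have "(real k + 1/2, y) \<in> path_points_from (0, real 0) q"
      using y by (simp add: path_points_def)
    from path_points_from_above_columns[OF this] obtain k' s'' t'' u where
      *: "column_heights 0 q ! k' = (s'', t'')" "0 \<le> u" "u \<le> 1"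
        "real k + 1/2 = real k' + u" "real s'' + u * (real t'' - real s'') \<le> y"
      by auto
    \<comment> \<open>An abscissa strictly inside column \<open>k\<close> belongs to no other
      column.\<close>
    have "real k < real k' + 1" "real k' < real k + 1" using * by linarith+
    then have "k = k'" by linarith
    with * have "u = 1/2" by linarith
    have "s'' = s'" "t'' = t'" using * q \<open>k = k'\<close> by auto
    with * \<open>u = 1/2\<close> have "real s' + 1/2 * (real t' - real s') \<le> y" by blast
    with y have "s' + t' \<le> s + t" by (simp add: field_simps flip: of_nat_add)
    \<comment> \<open>Each pair differs by 0 or 1, so a failure at either edge would give
      \<open>s' + t' > s + t\<close>.\<close>
    with st st' show ?thesis by (auto simp: col_le_def p q)
  qed
  then show "list_all2 col_le (column_heights 0 q) (column_heights 0 p)"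
    using len by (simp add: list_all2_conv_all_nth)
next
  assume le: "list_all2 col_le (column_heights 0 q) (column_heights 0 p)"
  show "weakly_above p q" unfolding weakly_above_def
  proof safe
    fix x y assume "(x, y) \<in> path_points p"
    then have "(x, y) \<in> path_points_from (0, real 0) p" by (simp add: path_points_def)
    from path_points_from_above_columns[OF this]
    show "\<exists>y'. (x, y') \<in> path_points q \<and> y' \<le> y"
    proof (elim disjE exE conjE)
      assume "x = 0" "real 0 \<le> y"
      then show ?thesis
        using start_in_path_points_from[of "(0, 0)" q]
        by (intro exI[of _ 0]) (auto simp: path_points_def)
    next
      fix k s t u
      assume k: "k < length (column_heights 0 p)" and p: "column_heights 0 p ! k = (s, t)"
        and u: "0 \<le> u" "u \<le> 1" and x: "x = 0 + real k + u"
        and y: "real s + u * (real t - real s) \<le> y"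
      obtain s' t' where q: "column_heights 0 q ! k = (s', t')" by force
      have "s' \<le> s" "t' \<le> t"
        using list_all2_nthD2[OF le k] p q by (auto simp: col_le_def)
      then have "(1 - u) * real s' + u * real t' \<le> (1 - u) * real s + u * real t"
        using u by (intro add_mono mult_left_mono) auto
      with y have "real s' + u * (real t' - real s') \<le> y" by (simp add: algebra_simps)
      moreover have "(x, real s' + u * (real t' - real s')) \<in> path_points q"
        using path_points_from_columns[of k 0 q s' t' u 0] k q u x len by (simp add: path_points_def)
      ultimately show ?thesis by blast
    qed
  qed
qed

section \<open>Expanding diagonal steps\<close>

definition expand :: "step \<Rightarrow> step \<Rightarrow> step list \<Rightarrow> step list" where
  "expand c d p = concat (map (\<lambda>s. if s = Diag then [c, d] else [s]) p)"

lemma expand_simps [simp]: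
  "expand c d [] = []"
  "expand c d (s # p) = (if s = Diag then c # d # expand c d p else s # expand c d p)"
  by (simp_all add: expand_def)

text \<open>With \<open>North\<close>, \<open>East\<close> this counts peaks; with
  \<open>East\<close>, \<open>North\<close>, valleys.\<close>

fun adjacent :: "step \<Rightarrow> step \<Rightarrow> step list \<Rightarrow> nat" where
  "adjacent c d (x # y # p) = (if x = c \<and> y = d then 1 else 0) + adjacent c d (y # p)"
| "adjacent c d p = 0"

lemma fiber_expand_Cons:
  assumes "x \<noteq> Diag" "\<not> (x = c \<and> p \<noteq> [] \<and> hd p = d)"
  shows "{q. expand c d q = x # p} = Cons x ` {q. expand c d q = p}"
proof -
  have "\<exists>q'. q = x # q' \<and> expand c d q' = p" if "expand c d q = x # p" for q
    using that assms by (cases q) (auto split: if_splits)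
  then show ?thesis using assms by auto
qed

text \<open>Each occurrence of \<open>c\<close>, \<open>d\<close> in \<open>p\<close> either stood
  in \<open>q\<close> already or came from a \<open>Diag\<close>. As \<open>c \<noteq> d\<close>,
  occurrences do not overlap, so these choices are independent.\<close>

lemma card_fiber_expand:
  assumes "Diag \<notin> set p" "c \<noteq> d"
  shows "finite {q. expand c d q = p} \<and> card {q. expand c d q = p} = 2 ^ adjacent c d p"
  using assms
proof (induction p rule: length_induct)
  case (1 p)
  show ?case
  proof (cases p)
    case Nil
    have "q = []" if "expand c d q = []" for q
      using that by (cases q) (auto split: if_splits)
    then have "{q. expand c d q = []} = {[]}" by auto
    then show ?thesis using Nil by simp
  next
    case (Cons x r)
    show ?thesis
    proof (cases "x = c \<and> r \<noteq> [] \<and> hd r = d")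
      case False
      have "adjacent c d p = adjacent c d r"
        using False Cons by (cases r) auto
      moreover have "finite {q. expand c d q = r} \<and> card {q. expand c d q = r} = 2 ^ adjacent c d r"
        using 1 Cons by auto
      moreover have "{q. expand c d q = p} = Cons x ` {q. expand c d q = r}"
        unfolding Cons using False 1 Cons by (intro fiber_expand_Cons) auto
      ultimately show ?thesis by (simp add: card_image)
    next
      case True
      then obtain r' where r: "r = d # r'" by (cases r) auto
      let ?F = "{q. expand c d q = r'}"
      have IH: "finite ?F" "card ?F = 2 ^ adjacent c d r'"
        using 1 Cons r by auto
      \<comment> \<open>The pair formed by \<open>d\<close> and the head of \<open>r'\<close> does
        not count, because \<open>d \<noteq> c\<close>.\<close>
      have adj: "adjacent c d p = Suc (adjacent c d r')"
        using True Cons r 1 by (cases r') auto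
      have "\<exists>q'. (q = c # d # q' \<or> q = Diag # q') \<and> expand c d q' = r'" if "expand c d q = p" for q
      proof (cases q)
        case (Cons a qa)
        then show ?thesis
          using that True \<open>p = x # r\<close> r 1 by (cases qa) (auto split: if_splits)
      qed (use that \<open>p = x # r\<close> in simp)
      then have eq: "{q. expand c d q = p} = (\<lambda>q. c # d # q) ` ?F \<union> Cons Diag ` ?F"
        using True Cons r 1 by auto
      have "c \<noteq> Diag" using True Cons 1 by auto
      then have "card {q. expand c d q = p} =
          card ((\<lambda>q. c # d # q) ` ?F) + card (Cons Diag ` ?F)"
        unfolding eq by (intro card_Un_disjoint) (auto simp: IH)
      also have "\<dots> = 2 ^ adjacent c d p"
        using IH adj by (simp add: card_image inj_on_def)
      finally show ?thesis using eq IH by simp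
    qed
  qed
qed

lemma Diag_notin_expand: "c \<noteq> Diag \<Longrightarrow> d \<noteq> Diag \<Longrightarrow> Diag \<notin> set (expand c d p)"
  by (induction p) auto

lemma lattice_path_iff: "lattice_path p z \<longleftrightarrow> schroder_path p z \<and> Diag \<notin> set p"
proof -
  have "set p \<subseteq> {North, East} \<longleftrightarrow> Diag \<notin> set p"
    using step.exhaust by auto
  then show ?thesis by (simp add: lattice_path_def)
qed

lemma schroder_path_expand:
  assumes "step_vec c + step_vec d = (1, 1)"
  shows "schroder_path (expand c d p) z \<longleftrightarrow> schroder_path p z"
proof -
  have "fst (step_vec c) + fst (step_vec d) = 1" "snd (step_vec c) + snd (step_vec d) = 1"
    using assms by (simp_all add: prod_eq_iff)
  then have "(\<Sum>s\<leftarrow>expand c d p. fst (step_vec s)) = (\<Sum>s\<leftarrow>p. fst (step_vec s))"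
    "(\<Sum>s\<leftarrow>expand c d p. snd (step_vec s)) = (\<Sum>s\<leftarrow>p. snd (step_vec s))"
    by (induction p) (auto simp flip: add.assoc)
  then show ?thesis by (simp add: schroder_path_def)
qed

text \<open>Going east first crosses the column at its left height; going north first, as in the
  next lemma, at its right height.\<close>

lemma columns_expand_EN: "column_heights j (expand East North p) = map (\<lambda>(s, t). (s, s)) (column_heights j p)"
  by (induction j p rule: column_heights.induct) auto

lemma columns_expand_NE: "column_heights j (expand North East p) = map (\<lambda>(s, t). (t, t)) (column_heights j p)"
  by (induction j p rule: column_heights.induct) auto

section \<open>Replacing peaks by diagonals\<close>

lemma peaks_to_diag_North:
  "p = [] \<or> hd p \<noteq> East \<Longrightarrow> peaks_to_diag (North # p) = North # peaks_to_diag p"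
proof (cases p)
  case (Cons s q)
  then show "p = [] \<or> hd p \<noteq> East \<Longrightarrow> ?thesis" by (cases s) auto
qed simp

text \<open>Regroups the recursion by first step, with a \<open>North\<close> that opens no peak as
  a case of its own.\<close>

lemma peaks_to_diag_induct [case_names Nil Peak East Diag North]:
  assumes "P []" "\<And>p. P p \<Longrightarrow> P (North # East # p)"
    "\<And>p. P p \<Longrightarrow> P (East # p)" "\<And>p. P p \<Longrightarrow> P (Diag # p)"
    "\<And>p. P p \<Longrightarrow> p = [] \<or> hd p \<noteq> East \<Longrightarrow> P (North # p)"
  shows "P p"
proof (induction p rule: peaks_to_diag.induct)
  case ("2_3" s) then show ?case using assms by (cases s) auto
next
  case ("2_4" s p) then show ?case using assms by (cases s) auto
next
  case ("2_5" s p) then show ?case using assms by (cases s) auto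
qed (use assms in auto)

text \<open>A peak and its diagonal leave the column at the same height; only the left height drops
  by one.\<close>

lemma map_snd_columns_peaks_to_diag:
  "map snd (column_heights j (peaks_to_diag p)) = map snd (column_heights j p)"
  by (induction p arbitrary: j rule: peaks_to_diag_induct) (auto simp: peaks_to_diag_North)

text \<open>Right heights force left heights. At a peak, \<open>p\<close> rises by at most 1 in the
  column, so ending at \<open>Suc l\<close> or higher it began at \<open>l\<close> or higher. At an
  East outside a peak, \<open>p\<close> enters at \<open>j\<close> or higher, and
  \<open>l \<le> j\<close> comes from the previous column. That invariant is asked for only before
  an East, so it may lapse after a North that opens no peak.\<close>

lemma columns_peaks_to_diag_le:
  assumes "Diag \<notin> set \<nu>" "\<nu> \<noteq> [] \<and> hd \<nu> = East \<longrightarrow> l \<le> j"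
    "list_all2 (\<lambda>c d. snd c \<le> snd d) (column_heights l \<nu>) (column_heights j p)"
  shows "list_all2 col_le (column_heights l (peaks_to_diag \<nu>)) (column_heights j p)"
  using assms
proof (induction \<nu> arbitrary: l j p rule: peaks_to_diag_induct)
  case (Peak \<nu>)
  then obtain s t cs where c: "column_heights j p = (s, t) # cs" "Suc l \<le> t"
    and cs: "list_all2 (\<lambda>c d. snd c \<le> snd d) (column_heights (Suc l) \<nu>) cs"
    by (auto simp: list_all2_Cons1)
  obtain p' where "cs = column_heights t p'" using columns_Cons_tail[OF c(1)] by blast
  moreover have "t \<le> Suc s" using columns_bounds[of s t j p] c by simp
  ultimately show ?case using c cs Peak by (auto simp: col_le_def)
next
  case (East \<nu>)
  then obtain s t cs where c: "column_heights j p = (s, t) # cs"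
    and cs: "list_all2 (\<lambda>c d. snd c \<le> snd d) (column_heights l \<nu>) cs"
    by (auto simp: list_all2_Cons1)
  obtain p' where "cs = column_heights t p'" using columns_Cons_tail[OF c] by blast
  moreover have "j \<le> s" "s \<le> t" using columns_bounds[of s t j p] c by simp_all
  ultimately show ?case using c cs East by (auto simp: col_le_def)
qed (auto simp: peaks_to_diag_North)

text \<open>Columns of \<open>\<nu>\<close> are flat, so the left heights of \<open>p\<close>, the
  smaller ones, decide.\<close>

lemma weakly_above_expand_EN:
  assumes "schroder_path p (b, a)" "lattice_path \<nu> (b, a)"
  shows "weakly_above (expand East North p) \<nu> \<longleftrightarrow> weakly_above p \<nu>"
proof -
  have len: "length (column_heights 0 p) = length (column_heights 0 \<nu>)"
    using assms by (simp add: length_columns lattice_path_def schroder_path_def)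
  have "col_le (column_heights 0 \<nu> ! k) ((\<lambda>(s, t). (s, s)) (column_heights 0 p ! k)) \<longleftrightarrow>
      col_le (column_heights 0 \<nu> ! k) (column_heights 0 p ! k)" if k: "k < length (column_heights 0 p)" for k
  proof -
    obtain s t where p: "column_heights 0 p ! k = (s, t)" by force
    obtain s' t' where q: "column_heights 0 \<nu> ! k = (s', t')" by force
    have "s \<le> t" using columns_bounds[of s t 0 p] k p by (metis nth_mem)
    moreover have "s' = t'"
      using columns_lattice[of \<nu> s' t' 0] k q len assms(2)
      by (metis nth_mem lattice_path_iff)
    ultimately show ?thesis using p q by (auto simp: col_le_def)
  qed
  then show ?thesis
    using len by (auto simp: weakly_above_iff_columns columns_expand_EN list_all2_conv_all_nth)
qed

text \<open>Both sides reduce to comparing right heights of \<open>p\<close> and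
  \<open>\<nu>\<close>: on the left because \<open>\<nu>\<close> has flat columns, on the right
  because the diagonals keep right heights and \<open>columns_peaks_to_diag_le\<close> supplies the
  left ones.\<close>

lemma weakly_above_expand_NE:
  assumes "schroder_path p (b, a)" "lattice_path \<nu> (b, a)"
  shows "weakly_above (expand North East p) \<nu> \<longleftrightarrow> weakly_above p (peaks_to_diag \<nu>)"
proof -
  have len: "length (column_heights 0 p) = length (column_heights 0 \<nu>)"
    using assms by (simp add: length_columns lattice_path_def schroder_path_def)
  have len': "length (column_heights 0 (peaks_to_diag \<nu>)) = length (column_heights 0 \<nu>)"
    by (metis length_map map_snd_columns_peaks_to_diag)
  have Diag: "Diag \<notin> set \<nu>" using assms(2) by (simp add: lattice_path_iff)
  have "weakly_above (expand North East p) \<nu> \<longleftrightarrow>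
      list_all2 (\<lambda>c d. snd c \<le> snd d) (column_heights 0 \<nu>) (column_heights 0 p)"
  proof -
    have "col_le (column_heights 0 \<nu> ! k) ((\<lambda>(s, t). (t, t)) (column_heights 0 p ! k)) \<longleftrightarrow>
        snd (column_heights 0 \<nu> ! k) \<le> snd (column_heights 0 p ! k)" if k: "k < length (column_heights 0 p)" for k
    proof -
      obtain s' t' where q: "column_heights 0 \<nu> ! k = (s', t')" by force
      have "s' = t'" using columns_lattice[OF Diag, of s' t' 0] k q len by (metis nth_mem)
      then show ?thesis using q by (auto simp: col_le_def split: prod.split)
    qed
    then show ?thesis
      using len by (auto simp: weakly_above_iff_columns columns_expand_NE list_all2_conv_all_nth)
  qed
  also have "\<dots> \<longleftrightarrow> list_all2 col_le (column_heights 0 (peaks_to_diag \<nu>)) (column_heights 0 p)"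
  proof
    assume "list_all2 (\<lambda>c d. snd c \<le> snd d) (column_heights 0 \<nu>) (column_heights 0 p)"
    with Diag show "list_all2 col_le (column_heights 0 (peaks_to_diag \<nu>)) (column_heights 0 p)"
      by (intro columns_peaks_to_diag_le) auto
  next
    assume "list_all2 col_le (column_heights 0 (peaks_to_diag \<nu>)) (column_heights 0 p)"
    then have "list_all2 (\<le>) (map snd (column_heights 0 (peaks_to_diag \<nu>))) (map snd (column_heights 0 p))"
      by (auto simp: list_all2_conv_all_nth col_le_def)
    then show "list_all2 (\<lambda>c d. snd c \<le> snd d) (column_heights 0 \<nu>) (column_heights 0 p)"
      by (simp add: map_snd_columns_peaks_to_diag list_all2_map1 list_all2_map2)
  qed
  also have "\<dots> \<longleftrightarrow> weakly_above p (peaks_to_diag \<nu>)"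
    using len len' by (simp add: weakly_above_iff_columns)
  finally show ?thesis .
qed

section \<open>Counting by lattice paths\<close>

definition lattice_paths_above :: "nat \<times> nat \<Rightarrow> step list \<Rightarrow> step list set" where
  "lattice_paths_above z \<nu> = {\<pi>. lattice_path \<pi> z \<and> weakly_above \<pi> \<nu>}"

lemma finite_lattice_paths_above: "finite (lattice_paths_above z \<nu>)"
proof -
  have "length \<pi> = (\<Sum>s\<leftarrow>\<pi>. fst (step_vec s)) + (\<Sum>s\<leftarrow>\<pi>. snd (step_vec s))"
    if "set \<pi> \<subseteq> {North, East}" for \<pi>
    using that by (induction \<pi>) auto
  then have "lattice_paths_above z \<nu> \<subseteq> {\<pi>. set \<pi> \<subseteq> {North, East} \<and> length \<pi> = fst z + snd z}"
    by (auto simp: lattice_paths_above_def lattice_path_def schroder_path_def)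
  moreover have "finite {\<pi>. set \<pi> \<subseteq> {North, East} \<and> length \<pi> = fst z + snd z}"
    by (rule finite_lists_length_eq) simp
  ultimately show ?thesis by (rule finite_subset)
qed

text \<open>Fibres over distinct paths are disjoint, so their sizes add up.\<close>

lemma card_vimage_expand:
  assumes "c \<noteq> d" "finite A" "\<And>\<pi>. \<pi> \<in> A \<Longrightarrow> Diag \<notin> set \<pi>"
  shows "card {p. expand c d p \<in> A} = (\<Sum>\<pi>\<in>A. 2 ^ adjacent c d \<pi>)"
proof -
  have "{p. expand c d p \<in> A} = (\<Union>\<pi>\<in>A. {p. expand c d p = \<pi>})" by auto
  also have "card \<dots> = (\<Sum>\<pi>\<in>A. card {p. expand c d p = \<pi>})"
    using assms card_fiber_expand by (intro card_UN_disjoint) auto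
  also have "\<dots> = (\<Sum>\<pi>\<in>A. 2 ^ adjacent c d \<pi>)"
    using assms card_fiber_expand by (intro sum.cong) auto
  finally show ?thesis .
qed

text \<open>Expanding keeps the endpoint, removes every \<open>Diag\<close> and preserves lying
  above \<open>\<nu>\<close>, so the small paths are exactly the preimages of the lattice paths
  above \<open>\<nu>\<close>.\<close>

lemma card_small_schroder_paths:
  assumes "lattice_path \<nu> (b, a)"
  shows "card (small_schroder_paths (b, a) \<nu>) =
    (\<Sum>\<pi>\<in>lattice_paths_above (b, a) \<nu>. 2 ^ adjacent East North \<pi>)"
proof -
  have "small_schroder_paths (b, a) \<nu> = {p. expand East North p \<in> lattice_paths_above (b, a) \<nu>}"
    using weakly_above_expand_EN[OF _ assms]
    by (auto simp: small_schroder_paths_def lattice_paths_above_def lattice_path_iff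
        schroder_path_expand Diag_notin_expand)
  moreover have "Diag \<notin> set \<pi>" if "\<pi> \<in> lattice_paths_above (b, a) \<nu>" for \<pi>
    using that by (simp add: lattice_paths_above_def lattice_path_iff)
  ultimately show ?thesis
    by (simp add: card_vimage_expand finite_lattice_paths_above)
qed

lemma card_large_schroder_paths:
  assumes "lattice_path \<nu> (b, a)"
  shows "card (large_schroder_paths (b, a) \<nu>) =
    (\<Sum>\<pi>\<in>lattice_paths_above (b, a) \<nu>. 2 ^ adjacent North East \<pi>)"
proof -
  have "large_schroder_paths (b, a) \<nu> = {p. expand North East p \<in> lattice_paths_above (b, a) \<nu>}"
    using weakly_above_expand_NE[OF _ assms]
    by (auto simp: large_schroder_paths_def lattice_paths_above_def lattice_path_iff
        schroder_path_expand Diag_notin_expand)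
  moreover have "Diag \<notin> set \<pi>" if "\<pi> \<in> lattice_paths_above (b, a) \<nu>" for \<pi>
    using that by (simp add: lattice_paths_above_def lattice_path_iff)
  ultimately show ?thesis
    by (simp add: card_vimage_expand finite_lattice_paths_above)
qed

section \<open>Peaks versus valleys\<close>

text \<open>Peaks and valleys alternate. The first turn is a peak if the path starts with
  \<open>North\<close>, the last one if it ends with \<open>East\<close>; each failure costs one
  peak.\<close>

lemma peaks_valleys:
  assumes "set \<pi> \<subseteq> {North, East}" "\<pi> \<noteq> []"
  shows "adjacent North East \<pi> + of_bool (hd \<pi> = East) + of_bool (last \<pi> = North) =
    Suc (adjacent East North \<pi>)"
  using assms by (induction "East" "North" \<pi> rule: adjacent.induct) auto

lemma two_power_peaks_le:
  assumes "set \<pi> \<subseteq> {North, East}"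
  shows "(2::nat) ^ adjacent North East \<pi> \<le> 2 * 2 ^ adjacent East North \<pi>"
proof (cases "\<pi> = []")
  case False
  then have "adjacent North East \<pi> \<le> Suc (adjacent East North \<pi>)"
    using peaks_valleys[OF assms] by simp
  then have "(2::nat) ^ adjacent North East \<pi> \<le> 2 ^ Suc (adjacent East North \<pi>)"
    by (intro power_increasing) auto
  then show ?thesis by simp
qed simp

text \<open>Equal powers of 2 have equal exponents, so both correction terms in
  \<open>peaks_valleys\<close> must vanish. The empty path compares 1 with 2.\<close>

lemma two_power_peaks_eq_iff:
  assumes "set \<pi> \<subseteq> {North, East}"
  shows "(2::nat) ^ adjacent North East \<pi> = 2 * 2 ^ adjacent East North \<pi> \<longleftrightarrow>
    \<pi> \<noteq> [] \<and> hd \<pi> = North \<and> last \<pi> = East"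
proof (cases "\<pi> = []")
  case False
  have "(2::nat) ^ adjacent North East \<pi> = 2 * 2 ^ adjacent East North \<pi> \<longleftrightarrow>
      (2::nat) ^ adjacent North East \<pi> = 2 ^ Suc (adjacent East North \<pi>)" by simp
  also have "\<dots> \<longleftrightarrow> adjacent North East \<pi> = Suc (adjacent East North \<pi>)"
    by (rule power_inject_exp) simp
  also have "\<dots> \<longleftrightarrow> hd \<pi> \<noteq> East \<and> last \<pi> \<noteq> North"
    using peaks_valleys[OF assms False] by (auto simp: of_bool_def split: if_splits)
  also have "\<dots> \<longleftrightarrow> hd \<pi> = North \<and> last \<pi> = East"
    using assms hd_in_set[OF False] last_in_set[OF False] by auto
  finally show ?thesis using False by simp
qed simp

text \<open>The first column of \<open>\<nu>\<close> has height at least 1, so \<open>\<pi>\<close>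
  must climb before it. The last has full height \<open>a\<close>, so \<open>\<pi>\<close> has no
  North left after it.\<close>

lemma shape_of_lattice_path_above:
  assumes \<nu>: "lattice_path \<nu> (b, a)" "\<nu> \<noteq> []" "hd \<nu> = North" "last \<nu> = East"
    and \<pi>: "lattice_path \<pi> (b, a)" "weakly_above \<pi> \<nu>"
  shows "\<pi> \<noteq> [] \<and> hd \<pi> = North \<and> last \<pi> = East"
proof -
  have le: "list_all2 col_le (column_heights 0 \<nu>) (column_heights 0 \<pi>)"
    using \<nu> \<pi> by (simp add: weakly_above_iff_columns length_columns lattice_path_def
        schroder_path_def)
  obtain \<nu>1 where \<nu>1: "\<nu> = North # \<nu>1" using \<nu> by (cases \<nu>) auto
  obtain \<nu>2 where \<nu>2: "\<nu> = \<nu>2 @ [East]" using \<nu> by (metis append_butlast_last_id)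
  have "(\<Sum>s\<leftarrow>\<nu>2. snd (step_vec s)) = a"
    using \<nu>(1) \<nu>2 by (simp add: lattice_path_def schroder_path_def)
  then have cols: "column_heights 0 \<nu> = column_heights 0 \<nu>2 @ [(a, a)]"
    by (simp add: \<nu>2 columns_append)
  then have "column_heights 0 \<pi> \<noteq> []" using le by auto
  then have ne: "\<pi> \<noteq> []" by auto
  have "hd \<pi> \<noteq> East"
  proof
    assume "hd \<pi> = East"
    then obtain \<pi>' where \<pi>': "\<pi> = East # \<pi>'" using ne by (cases \<pi>) auto
    have "column_heights 0 \<nu> \<noteq> []" by (simp add: cols)
    then obtain s t cs where c: "column_heights 0 \<nu> = (s, t) # cs"
      by (metis neq_Nil_conv surj_pair)
    \<comment> \<open>After its leading \<open>North\<close>, the columns of \<open>\<nu>\<close>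
      are those of \<open>\<nu>1\<close> started at height 1.\<close>
    then have "1 \<le> s" using columns_bounds[of s t 1 \<nu>1] \<nu>1 by simp
    then show False using le c \<pi>' by (simp add: col_le_def)
  qed
  moreover have "last \<pi> \<noteq> North"
  proof
    assume "last \<pi> = North"
    then obtain \<pi>' where \<pi>': "\<pi> = \<pi>' @ [North]" using ne by (metis append_butlast_last_id)
    then have h: "Suc (\<Sum>s\<leftarrow>\<pi>'. snd (step_vec s)) = a"
      using \<pi>(1) by (simp add: lattice_path_def schroder_path_def)
    obtain cs s t where c: "column_heights 0 \<pi> = cs @ [(s, t)]" "a \<le> t"
      using le cols by (auto simp: list_all2_append1 list_all2_Cons1 col_le_def)
    \<comment> \<open>The final \<open>North\<close> adds no column, so every column of
      \<open>\<pi>\<close> stays within the height of \<open>\<pi>'\<close>, one short of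
      \<open>a\<close>.\<close>
    then have "(s, t) \<in> set (column_heights 0 \<pi>')" using \<pi>' by (simp add: columns_append)
    then have "t \<le> (\<Sum>s\<leftarrow>\<pi>'. snd (step_vec s))" using columns_bounds by fastforce
    then show False using c h by simp
  qed
  moreover have "hd \<pi> \<in> {North, East}" "last \<pi> \<in> {North, East}"
    using \<pi>(1) hd_in_set[OF ne] last_in_set[OF ne] unfolding lattice_path_def by blast+
  ultimately show ?thesis using ne by auto
qed

theorem theorem2p3:
  fixes \<nu> :: "step list" and a b :: nat
  assumes "lattice_path \<nu> (b, a)"
  shows "card (large_schroder_paths (b, a) \<nu>) = 2 * card (small_schroder_paths (b, a) \<nu>)
    \<longleftrightarrow> \<nu> \<noteq> [] \<and> hd \<nu> = North \<and> last \<nu> = East"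
proof -
  define A where "A = lattice_paths_above (b, a) \<nu>"
  have fin: "finite A" by (simp add: A_def finite_lattice_paths_above)
  have steps: "set \<pi> \<subseteq> {North, East}" if "\<pi> \<in> A" for \<pi>
    using that by (simp add: A_def lattice_paths_above_def lattice_path_def)
  have "weakly_above \<nu> \<nu>"
    by (simp add: weakly_above_iff_columns list_all2_refl col_le_def)
  then have \<nu>: "\<nu> \<in> A" using assms by (simp add: A_def lattice_paths_above_def)
  have "card (large_schroder_paths (b, a) \<nu>) = 2 * card (small_schroder_paths (b, a) \<nu>) \<longleftrightarrow>
      (\<Sum>\<pi>\<in>A. (2::nat) ^ adjacent North East \<pi>) = (\<Sum>\<pi>\<in>A. 2 * 2 ^ adjacent East North \<pi>)"
    using assms
    by (simp add: card_small_schroder_paths card_large_schroder_paths A_def sum_distrib_left)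
  also have "\<dots> \<longleftrightarrow> (\<forall>\<pi>\<in>A. (2::nat) ^ adjacent North East \<pi> = 2 * 2 ^ adjacent East North \<pi>)"
  proof
    \<comment> \<open>Each term on the left is at most its counterpart, so equal finite sums force
      equal terms.\<close>
    assume eq: "(\<Sum>\<pi>\<in>A. (2::nat) ^ adjacent North East \<pi>) = (\<Sum>\<pi>\<in>A. 2 * 2 ^ adjacent East North \<pi>)"
    show "\<forall>\<pi>\<in>A. (2::nat) ^ adjacent North East \<pi> = 2 * 2 ^ adjacent East North \<pi>"
      using sum_mono_inv[OF eq _ _ fin] two_power_peaks_le steps by blast
  qed simp
  also have "\<dots> \<longleftrightarrow> (\<forall>\<pi>\<in>A. \<pi> \<noteq> [] \<and> hd \<pi> = North \<and> last \<pi> = East)"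
    using two_power_peaks_eq_iff steps by (intro ball_cong) auto
  \<comment> \<open>\<open>\<nu>\<close> itself lies in \<open>A\<close>, and its shape passes to
    every path above it.\<close>
  also have "\<dots> \<longleftrightarrow> \<nu> \<noteq> [] \<and> hd \<nu> = North \<and> last \<nu> = East"
    using \<nu> shape_of_lattice_path_above[OF assms]
    by (auto simp: A_def lattice_paths_above_def)
  finally show ?thesis .
qed

end
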